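(* Every locally compact polyhedron is a $\mathscr{C}^\infty$-approximation target space.
   Context: All subsets of Euclidean spaces carry the relative Euclidean topology; $\mathbb{R}^+:=\{t\in\mathbb{R}: t>0\}$. A locally compact polyhedron of $\mathbb{R}^q$ is the realization $|L|\subset\mathbb{R}^q$ of a locally finite simplicial complex $L$ of $\mathbb{R}^q$ (each point of $|L|$ has a neighborhood in $|L|$ meeting only finitely many simplices). A non-empty set $Y\subset\mathbb{R}^n$ is triangulable if it is homeomorphic to a locally compact polyhedron of some $\mathbb{R}^q$. For $X\subset\mathbb{R}^m$ locally compact and $Y\subset\mathbb{R}^n$, a map $g:X\to Y$ is a $\mathscr{C}^\infty$ map if there exist an open neighborhood $U\subset\mathbb{R}^m$ of $X$ (in which $X$ is closed) and a map $G:U\to\mathbb{R}^n$ of class $\mathscr{C}^\infty$ in the standard sense such that $g(x)=G(x)$ for each $x\in X$. $\mathscr{C}^0(X,Y)$ (resp. $\mathscr{C}^\infty(X,Y)$) is the set of continuous (resp. $\mathscr{C}^\infty$) maps from $X$ to $Y$. The strong (Whitney) $\mathscr{C}^0$ topology on $\mathscr{C}^0(X,Y)$ has as fundamental system of neighborhoods of $f$ the sets $\{g\in\mathscr{C}^0(X,Y): \|g(x)-f(x)\|_n<\varepsilon(x)\ \forall x\in X\}$, where $\|\cdot\|_n$ is the Euclidean norm and $\varepsilon:X\to\mathbb{R}^+$ is a strictly positive continuous function. A triangulable set $Y\subset\mathbb{R}^n$ is a $\mathscr{C}^\infty$-approximation target space if $\mathscr{C}^\infty(X,Y)$ is dense in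 $\mathscr{C}^0(X,Y)$ (strong $\mathscr{C}^0$ topology) for each locally compact subset $X$ of each Euclidean space $\mathbb{R}^m$, $m\in\mathbb{N}$. *)

theory Defs
  imports "HOL-Analysis.Analysis"
begin

section \<open>Locally compact polyhedra\<close>

text \<open>
  The library constant \<^const>\<open>simplicial_complex\<close> requires finitely many simplices and
  a Euclidean ambient type. Here finiteness is replaced by local finiteness, and the ambient type may
  be any normed space, because \<open>triangulable\<close> below needs such a space. As in the library,
  closure under \<^const>\<open>face_of\<close> makes the empty set a member of every non-empty complex; this
  affects neither the realization nor local finiteness.
\<close>

definition is_simplex :: "'a::real_vector set \<Rightarrow> bool" where
  "is_simplex S \<longleftrightarrow> (\<exists>C. finite C \<and> \<not> affine_dependent C \<and> S = convex hull C)"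

lemma is_simplex_iff: "is_simplex S \<longleftrightarrow> (\<exists>n. n simplex S)"
  for S :: "'a::euclidean_space set"
proof
  assume "is_simplex S"
  then obtain C where C: "finite C" "\<not> affine_dependent C" "S = convex hull C"
    unfolding is_simplex_def by blast
  then have "(int (card C) - 1) simplex S"
    unfolding simplex_def by (intro exI[of _ C]) auto
  then show "\<exists>n. n simplex S" ..
next
  assume "\<exists>n. n simplex S"
  then show "is_simplex S"
    unfolding is_simplex_def simplex by blast
qed

definition locally_finite_simplicial_complex :: "'a::real_normed_vector set set \<Rightarrow> bool" where
  "locally_finite_simplicial_complex L \<longleftrightarrow>
     (\<forall>S\<in>L. is_simplex S) \<and>
     (\<forall>F S. S \<in> L \<and> F face_of S \<longrightarrow> F \<in> L) \<and>
     (\<forall>S S'. S \<in> L \<and> S' \<in> L \<longrightarrow> (S \<inter> S') face_of S) \<and>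
     (\<forall>x\<in>\<Union>L. \<exists>V. openin (top_of_set (\<Union>L)) V \<and> x \<in> V \<and> finite {S\<in>L. S \<inter> V \<noteq> {}})"

lemma simplicial_complex_iff_finite:
  "simplicial_complex L \<longleftrightarrow> finite L \<and> locally_finite_simplicial_complex L"
  for L :: "'a::euclidean_space set set"
proof
  assume "simplicial_complex L"
  then show "finite L \<and> locally_finite_simplicial_complex L"
    unfolding simplicial_complex_def locally_finite_simplicial_complex_def is_simplex_iff
    by (auto intro!: exI[of _ "\<Union>L"])
next
  assume "finite L \<and> locally_finite_simplicial_complex L"
  then show "simplicial_complex L"
    unfolding simplicial_complex_def locally_finite_simplicial_complex_def is_simplex_iff by blast
qed

definition locally_compact_polyhedron :: "'a::real_normed_vector set \<Rightarrow> bool" where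
  "locally_compact_polyhedron P \<longleftrightarrow> (\<exists>L. locally_finite_simplicial_complex L \<and> P = \<Union>L)"

text \<open>
  Triangulability quantifies existentially over the dimension \<open>q\<close> of the space containing the
  polyhedron, which a type of dimension \<open>q\<close> cannot express. So the space of all \<open>q\<close>-tuples is
  realized as the space of real sequences that vanish from index \<open>q\<close> on, inside the
  bounded sequences. The ambient norm is the supremum norm; on these finite-dimensional
  subspaces it induces the Euclidean topology, and only the linear structure and the topology are
  used.
\<close>

definition coord_space :: "nat \<Rightarrow> (nat \<Rightarrow>\<^sub>C real) set" where
  "coord_space q = {x. \<forall>i\<ge>q. apply_bcontfun x i = 0}"

definition triangulable :: "'b::euclidean_space set \<Rightarrow> bool" where
  "triangulable Y \<longleftrightarrow>
     Y \<noteq> {} \<and> (\<exists>q. \<exists>P \<subseteq> coord_space q. locally_compact_polyhedron P \<and> Y homeomorphic P)"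


section \<open>Smooth maps\<close>

text \<open>Meant for open sets \<open>U\<close>: \<open>f\<close> is of class \<open>C\<^sup>k\<close> if it is differentiable
  and all its directional derivatives are of class \<open>C\<^bsup>k-1\<^esup>\<close>.\<close>

primrec Ck_on :: "nat \<Rightarrow> 'a::euclidean_space set \<Rightarrow> ('a \<Rightarrow> 'b::euclidean_space) \<Rightarrow> bool" where
  "Ck_on 0 U f \<longleftrightarrow> continuous_on U f"
| "Ck_on (Suc k) U f \<longleftrightarrow>
     (\<forall>x\<in>U. f differentiable (at x)) \<and> (\<forall>v. Ck_on k U (\<lambda>x. frechet_derivative f (at x) v))"

definition smooth_on :: "'a::euclidean_space set \<Rightarrow> ('a \<Rightarrow> 'b::euclidean_space) \<Rightarrow> bool" where
  "smooth_on U f \<longleftrightarrow> (\<forall>k. Ck_on k U f)"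

text \<open>Maps from \<open>X\<close> to \<open>Y\<close> are represented by functions in \<open>X \<rightarrow>\<^sub>E Y\<close>, that is, with a
  fixed value outside \<open>X\<close>, so that two maps are equal iff they agree on \<open>X\<close>.\<close>

definition C0_maps :: "'a::euclidean_space set \<Rightarrow> 'b::euclidean_space set \<Rightarrow> ('a \<Rightarrow> 'b) set" where
  "C0_maps X Y = {f \<in> X \<rightarrow>\<^sub>E Y. continuous_on X f}"

definition Cinf_maps :: "'a::euclidean_space set \<Rightarrow> 'b::euclidean_space set \<Rightarrow> ('a \<Rightarrow> 'b) set" where
  "Cinf_maps X Y = {g \<in> X \<rightarrow>\<^sub>E Y. \<exists>U G. open U \<and> X \<subseteq> U \<and> closedin (top_of_set U) X \<and>
                                     smooth_on U G \<and> (\<forall>x\<in>X. g x = G x)}"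

lemma Cinf_maps_subset_C0_maps: "Cinf_maps X Y \<subseteq> C0_maps X Y"
proof
  fix g assume g: "g \<in> Cinf_maps X Y"
  then obtain U G where "X \<subseteq> U" "smooth_on U G" and eq: "\<forall>x\<in>X. g x = G x"
    unfolding Cinf_maps_def by blast
  then have "continuous_on X G"
    unfolding smooth_on_def using Ck_on.simps(1) continuous_on_subset by metis
  then have "continuous_on X g"
    using eq by (simp cong: continuous_on_cong)
  with g show "g \<in> C0_maps X Y"
    unfolding Cinf_maps_def C0_maps_def by blast
qed


section \<open>The strong topology and approximation target spaces\<close>

definition strong_nbhd ::
  "'a::euclidean_space set \<Rightarrow> 'b::euclidean_space set \<Rightarrow> ('a \<Rightarrow> 'b) \<Rightarrow> ('a \<Rightarrow> real) \<Rightarrow> ('a \<Rightarrow> 'b) set"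
  where "strong_nbhd X Y f \<epsilon> = {g \<in> C0_maps X Y. \<forall>x\<in>X. norm (g x - f x) < \<epsilon> x}"

definition strong_C0_open ::
  "'a::euclidean_space set \<Rightarrow> 'b::euclidean_space set \<Rightarrow> ('a \<Rightarrow> 'b) set \<Rightarrow> bool"
  where "strong_C0_open X Y W \<longleftrightarrow> W \<subseteq> C0_maps X Y \<and>
    (\<forall>f\<in>W. \<exists>\<epsilon>. continuous_on X \<epsilon> \<and> (\<forall>x\<in>X. 0 < \<epsilon> x) \<and> strong_nbhd X Y f \<epsilon> \<subseteq> W)"

definition strong_C0_topology ::
  "'a::euclidean_space set \<Rightarrow> 'b::euclidean_space set \<Rightarrow> ('a \<Rightarrow> 'b) topology"
  where "strong_C0_topology X Y = topology (strong_C0_open X Y)"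

lemma istopology_strong_C0_open: "istopology (strong_C0_open X Y)"
  unfolding istopology_def
proof (intro conjI allI impI)
  fix S T assume S: "strong_C0_open X Y S" and T: "strong_C0_open X Y T"
  show "strong_C0_open X Y (S \<inter> T)"
    unfolding strong_C0_open_def
  proof (intro conjI ballI)
    show "S \<inter> T \<subseteq> C0_maps X Y" using S unfolding strong_C0_open_def by blast
    fix f assume f: "f \<in> S \<inter> T"
    obtain d where d: "continuous_on X d" "\<forall>x\<in>X. 0 < d x" "strong_nbhd X Y f d \<subseteq> S"
      using S f unfolding strong_C0_open_def by blast
    obtain e where e: "continuous_on X e" "\<forall>x\<in>X. 0 < e x" "strong_nbhd X Y f e \<subseteq> T"
      using T f unfolding strong_C0_open_def by blast
    have "continuous_on X (\<lambda>x. min (d x) (e x))"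
      using d e by (intro continuous_intros)
    moreover have "strong_nbhd X Y f (\<lambda>x. min (d x) (e x)) \<subseteq> S \<inter> T"
      using d(3) e(3) unfolding strong_nbhd_def by auto
    ultimately show "\<exists>\<epsilon>. continuous_on X \<epsilon> \<and> (\<forall>x\<in>X. 0 < \<epsilon> x) \<and> strong_nbhd X Y f \<epsilon> \<subseteq> S \<inter> T"
      using d(2) e(2) by (intro exI[of _ "\<lambda>x. min (d x) (e x)"]) auto
  qed
next
  fix \<K> assume K: "\<forall>K\<in>\<K>. strong_C0_open X Y K"
  show "strong_C0_open X Y (\<Union>\<K>)"
    unfolding strong_C0_open_def
  proof (intro conjI ballI)
    show "\<Union>\<K> \<subseteq> C0_maps X Y" using K unfolding strong_C0_open_def by blast
    fix f assume "f \<in> \<Union>\<K>"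
    then obtain W where W: "W \<in> \<K>" "f \<in> W" by blast
    then obtain \<epsilon> where "continuous_on X \<epsilon>" "\<forall>x\<in>X. 0 < \<epsilon> x" "strong_nbhd X Y f \<epsilon> \<subseteq> W"
      using K unfolding strong_C0_open_def by blast
    then show "\<exists>\<epsilon>. continuous_on X \<epsilon> \<and> (\<forall>x\<in>X. 0 < \<epsilon> x) \<and> strong_nbhd X Y f \<epsilon> \<subseteq> \<Union>\<K>"
      using W(1) by blast
  qed
qed

lemma openin_strong_C0_topology: "openin (strong_C0_topology X Y) = strong_C0_open X Y"
  unfolding strong_C0_topology_def by (rule topology_inverse'[OF istopology_strong_C0_open])

lemma topspace_strong_C0_topology: "topspace (strong_C0_topology X Y) = C0_maps X Y"
proof -
  have "strong_C0_open X Y (C0_maps X Y)"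
    unfolding strong_C0_open_def strong_nbhd_def by (auto intro!: exI[of _ "\<lambda>_. 1"])
  then show ?thesis
    unfolding topspace_def openin_strong_C0_topology by (auto simp: strong_C0_open_def)
qed

text \<open>The sets \<open>strong_nbhd X Y f \<epsilon>\<close> are open, so they do form a fundamental system of
  neighborhoods of \<open>f\<close>.\<close>

lemma openin_strong_nbhd:
  assumes f: "f \<in> C0_maps X Y" and e: "continuous_on X \<epsilon>"
  shows "openin (strong_C0_topology X Y) (strong_nbhd X Y f \<epsilon>)"
  unfolding openin_strong_C0_topology strong_C0_open_def
proof (intro conjI ballI)
  show "strong_nbhd X Y f \<epsilon> \<subseteq> C0_maps X Y" unfolding strong_nbhd_def by blast
  fix g assume g: "g \<in> strong_nbhd X Y f \<epsilon>"
  let ?d = "\<lambda>x. \<epsilon> x - norm (g x - f x)"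
  have "continuous_on X f" "continuous_on X g"
    using f g unfolding strong_nbhd_def C0_maps_def by auto
  then have "continuous_on X ?d"
    using e by (intro continuous_intros)
  moreover have "\<forall>x\<in>X. 0 < ?d x"
    using g unfolding strong_nbhd_def by auto
  moreover have "strong_nbhd X Y g ?d \<subseteq> strong_nbhd X Y f \<epsilon>"
  proof
    fix h assume h: "h \<in> strong_nbhd X Y g ?d"
    have "norm (h x - f x) < \<epsilon> x" if "x \<in> X" for x
    proof -
      have "norm (h x - g x) < ?d x" using h that unfolding strong_nbhd_def by blast
      then show ?thesis using norm_triangle_ineq[of "h x - g x" "g x - f x"] by simp
    qed
    then show "h \<in> strong_nbhd X Y f \<epsilon>" using h unfolding strong_nbhd_def by blast
  qed
  ultimately show "\<exists>d. continuous_on X d \<and> (\<forall>x\<in>X. 0 < d x) \<and> strong_nbhd X Y g d \<subseteq> strong_nbhd X Y f \<epsilon>"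
    by (intro exI[of _ ?d]) simp
qed

text \<open>The quantification over all Euclidean source spaces is expressed by the type argument: \<open>Y\<close> is a
  \<open>C\<^sup>\<infinity>\<close>-approximation target space iff the predicate holds for every Euclidean
  type \<open>'m\<close>, so \<open>'m\<close> is to be left as a free type variable. The zero-dimensional
  source space, which is not a Euclidean type, is covered by the one-point subsets of the
  other ones.\<close>

definition Cinf_approximation_target_space ::
  "'m::euclidean_space itself \<Rightarrow> 'n::euclidean_space set \<Rightarrow> bool"
  where "Cinf_approximation_target_space _ Y \<longleftrightarrow>
    triangulable Y \<and>
    (\<forall>X::'m set. locally compact X \<longrightarrow>
       strong_C0_topology X Y closure_of Cinf_maps X Y = C0_maps X Y)"

end

theory Submission
  imports Defs
begin

text \<open>
  The density of the smooth maps rests on one property of a locally finite complex \<open>L\<close>: every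
  point \<open>y\<close> of the polyhedron \<open>P = \<Union>L\<close> has a neighborhood \<open>N\<close> in \<open>P\<close> such that each simplex
  meeting \<open>N\<close> contains \<open>y\<close> (\<open>locally_finite_complex_nbhd\<close>). Hence, if \<open>f\<close> is a continuous map
  from \<open>X\<close> to \<open>P\<close> and \<open>x\<close> is close to \<open>c\<close> in \<open>X\<close>, every simplex that contains \<open>f x\<close> contains
  \<open>f c\<close> as well. So if \<open>f\<close> is replaced by an average \<open>\<Sum>j. \<phi>\<^sub>j(x) f(c\<^sub>j)\<close>, where \<open>\<phi>\<^sub>j\<close> is a
  smooth partition of unity and each \<open>\<phi>\<^sub>j\<close> vanishes outside a small ball around \<open>c\<^sub>j \<in> X\<close>, then
  at each \<open>x \<in> X\<close> all the values that occur lie in one simplex, any simplex containing \<open>f x\<close>. By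
  convexity the average lies in that simplex too, and by convexity of balls it is close to \<open>f x\<close>.
  The size of the supports may depend on \<open>c\<^sub>j\<close>, which is what the strong topology asks for. The
  averages are constructed in \<open>smooth_averaging\<close>, and \<open>smooth_approximation_into_polyhedron\<close>
  combines the two facts.

  Triangulability is a change of the ambient space: the coordinates of a point with respect to the
  standard basis define a linear embedding into the space of bounded sequences, and an injective linear
  map that is a homeomorphism onto its image carries the complex to a locally finite complex.
\<close>

section \<open>Calculus of smooth maps\<close>

lemma Ck_on_continuous: "Ck_on k U f \<Longrightarrow> continuous_on U f"
  by (cases k) (auto intro!: differentiable_imp_continuous_on differentiable_at_imp_differentiable_on)

lemma Ck_on_Suc_imp: "Ck_on (Suc k) U f \<Longrightarrow> Ck_on k U f"
proof (induction k arbitrary: f)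
  case 0
  then show ?case
    using Ck_on_continuous by fastforce
qed auto

lemma Ck_on_subset: "Ck_on k U f \<Longrightarrow> V \<subseteq> U \<Longrightarrow> Ck_on k V f"
  by (induction k arbitrary: f) (auto intro: continuous_on_subset)

text \<open>
  Openness of \<open>U\<close> matters: derivatives at the points of \<open>U\<close> see the values of a function in a
  full neighborhood.
\<close>
lemma Ck_on_cong:
  assumes "open U" "Ck_on k U f" "\<And>x. x \<in> U \<Longrightarrow> f x = g x"
  shows "Ck_on k U g"
  using assms(2,3)
proof (induction k arbitrary: f g)
  case 0
  then show ?case by (simp cong: continuous_on_cong)
next
  case (Suc k)
  have "g differentiable (at x)" if "x \<in> U" for x
    using Suc.prems that assms(1) unfolding Ck_on.simps differentiable_def
    by (metis has_derivative_transform_within_open)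
  moreover have "frechet_derivative f (at x) v = frechet_derivative g (at x) v" if "x \<in> U" for x v
    using frechet_derivative_transform_within_open[of f x U g] Suc.prems that assms(1) by simp
  ultimately show ?case
    using Suc.IH[of "\<lambda>x. frechet_derivative f (at x) _" "\<lambda>x. frechet_derivative g (at x) _"] Suc.prems(1)
    by simp
qed

text \<open>The induction step of every closure property below: any formula \<open>D\<close> for the derivative may take
  the place of \<open>frechet_derivative\<close>.\<close>
lemma Ck_on_Suc_I:
  assumes "open U" "\<And>x. x \<in> U \<Longrightarrow> (f has_derivative D x) (at x)"
    and "\<And>v. Ck_on k U (\<lambda>x. D x v)"
  shows "Ck_on (Suc k) U f"
proof -
  have "D x v = frechet_derivative f (at x) v" if "x \<in> U" for x v
    using frechet_derivative_at[OF assms(2)[OF that]] by simp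
  then have "Ck_on k U (\<lambda>x. frechet_derivative f (at x) v)" for v
    by (intro Ck_on_cong[OF assms(1) assms(3)]) auto
  then show ?thesis
    using assms(2) by (auto simp: differentiable_def)
qed

lemma Ck_on_SucD:
  assumes "Ck_on (Suc k) U f" "x \<in> U"
  shows "(f has_derivative frechet_derivative f (at x)) (at x)"
  using assms frechet_derivative_works by auto

text \<open>Sums with infinitely many terms are shown to be smooth by this lemma, since near each point they
  will agree with a finite sum.\<close>
lemma Ck_on_locally:
  assumes "\<And>x. x \<in> U \<Longrightarrow> \<exists>V. open V \<and> x \<in> V \<and> Ck_on k V f"
  shows "Ck_on k U f"
  using assms
proof (induction k arbitrary: f)
  case 0
  have "continuous (at x within U) f" if "x \<in> U" for x
    using 0[OF that] by (auto simp: continuous_on_eq_continuous_at continuous_at_imp_continuous_within)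
  then show ?case
    by (auto simp: continuous_on_eq_continuous_within)
next
  case (Suc k)
  have "f differentiable (at x)" if "x \<in> U" for x
    using Suc.prems[OF that] by auto
  moreover have "Ck_on k U (\<lambda>x. frechet_derivative f (at x) v)" for v
    by (rule Suc.IH) (use Suc.prems in fastforce)
  ultimately show ?case by simp
qed

lemma Ck_on_const: "Ck_on k U (\<lambda>x. c)"
  by (induction k arbitrary: c) auto

lemma Ck_on_add:
  assumes "open U"
  shows "Ck_on k U f \<Longrightarrow> Ck_on k U g \<Longrightarrow> Ck_on k U (\<lambda>x. f x + g x)"
proof (induction k arbitrary: f g)
  case 0
  then show ?case by (auto intro: continuous_intros)
next
  case (Suc k)
  show ?case
    by (rule Ck_on_Suc_I[OF assms has_derivative_add[OF Ck_on_SucD[OF Suc.prems(1)] Ck_on_SucD[OF Suc.prems(2)]]])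
      (use Suc in auto)
qed


lemma Ck_on_bounded_linear:
  assumes "bounded_linear f" "open U"
  shows "Ck_on k U f"
proof (cases k)
  case 0
  then show ?thesis by (simp add: linear_continuous_on assms(1))
next
  case (Suc n)
  have "Ck_on (Suc n) U f"
    by (rule Ck_on_Suc_I[OF assms(2) bounded_linear_imp_has_derivative[OF assms(1)]])
      (rule Ck_on_const)
  then show ?thesis using Suc by simp
qed

text \<open>The Leibniz rule, for the product, the scalar multiplication and the inner product at once.\<close>
lemma Ck_on_bounded_bilinear:
  assumes b: "bounded_bilinear b" and "open U"
  shows "Ck_on k U f \<Longrightarrow> Ck_on k U g \<Longrightarrow> Ck_on k U (\<lambda>x. b (f x) (g x))"
proof (induction k arbitrary: f g)
  case 0
  then show ?case by (auto intro: bounded_bilinear.continuous_on[OF b])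
next
  case (Suc k)
  have f: "Ck_on k U f" and g: "Ck_on k U g"
    using Suc.prems Ck_on_Suc_imp by blast+
  have D: "Ck_on k U (\<lambda>x. frechet_derivative f (at x) v)" "Ck_on k U (\<lambda>x. frechet_derivative g (at x) v)" for v
    using Suc.prems by simp_all
  show ?case
    by (rule Ck_on_Suc_I[OF assms(2)
          bounded_bilinear.FDERIV[OF b Ck_on_SucD[OF Suc.prems(1)] Ck_on_SucD[OF Suc.prems(2)]]],
        assumption, assumption)
      (rule Ck_on_add[OF assms(2) Suc.IH[OF f D(2)] Suc.IH[OF D(1) g]])
qed

lemma Ck_on_sum:
  "open U \<Longrightarrow> (\<And>i. i \<in> I \<Longrightarrow> Ck_on k U (f i)) \<Longrightarrow> Ck_on k U (\<lambda>x. \<Sum>i\<in>I. f i x)"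
  by (induction I rule: infinite_finite_induct) (auto intro: Ck_on_const Ck_on_add)

lemma Ck_on_prod:
  fixes f :: "'i \<Rightarrow> 'a::euclidean_space \<Rightarrow> real"
  shows "open U \<Longrightarrow> (\<And>i. i \<in> I \<Longrightarrow> Ck_on k U (f i)) \<Longrightarrow> Ck_on k U (\<lambda>x. \<Prod>i\<in>I. f i x)"
  by (induction I rule: infinite_finite_induct)
    (simp_all add: Ck_on_const Ck_on_bounded_bilinear[OF bounded_bilinear_mult])

lemma Ck_on_diff:
  assumes "open U" "Ck_on k U f" "Ck_on k U g"
  shows "Ck_on k U (\<lambda>x. f x - g x)"
  using Ck_on_add[OF assms(1,2) Ck_on_bounded_bilinear[OF bounded_bilinear_scaleR assms(1)
        Ck_on_const[of k U "-1::real"] assms(3)]]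
  by simp

text \<open>
  With a real function \<open>h\<close> on the outside, the chain rule expresses a directional derivative of the
  composition as a product of one of \<open>u\<close> with \<open>h' \<circ> u\<close>, so that the Leibniz rule and the induction
  hypothesis for \<open>h'\<close> suffice.
\<close>
lemma Ck_on_compose_real:
  fixes h :: "real \<Rightarrow> real"
  assumes "open U"
  shows "Ck_on k UNIV h \<Longrightarrow> Ck_on k U u \<Longrightarrow> Ck_on k U (\<lambda>x. h (u x))"
proof (induction k arbitrary: h)
  case 0
  then show ?case by (auto intro: continuous_on_compose2)
next
  case (Suc k)
  define h' where "h' = (\<lambda>y. frechet_derivative h (at y) 1)"
  have "(h has_real_derivative h' y) (at y)" for y
  proof -
    have "(h has_derivative frechet_derivative h (at y)) (at y)"
      using Ck_on_SucD[OF Suc.prems(1)] by simp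
    moreover from this have "frechet_derivative h (at y) = (*) (h' y)"
      using linear_cmul[OF has_derivative_linear, of h _ "at y" _ 1] by (auto simp: h'_def mult.commute)
    ultimately show ?thesis
      by (simp add: has_field_derivative_def)
  qed
  note D = DERIV_compose_FDERIV[OF this Ck_on_SucD[OF Suc.prems(2)]]
  have u: "Ck_on k U u" using Suc.prems(2) Ck_on_Suc_imp by blast
  have h': "Ck_on k UNIV h'" using Suc.prems(1) by (simp add: h'_def)
  have Du: "Ck_on k U (\<lambda>x. frechet_derivative u (at x) v)" for v
    using Suc.prems(2) by simp
  show ?case
    by (rule Ck_on_Suc_I[OF assms D], assumption)
      (rule Ck_on_bounded_bilinear[OF bounded_bilinear_mult assms Du Suc.IH[OF h' u]])
qed

section \<open>Smooth bump functions\<close>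

text \<open>
  The classical function \<open>exp (-1/x)\<close> is \<open>flat 1\<close>. The polynomial factor makes the family
  closed under differentiation.
\<close>
definition flat :: "real poly \<Rightarrow> real \<Rightarrow> real" where
  "flat p x = (if x > 0 then poly p (1 / x) * exp (- (1 / x)) else 0)"

lemma poly_mult_exp_neg_tendsto_0: "((\<lambda>s::real. poly p s * exp (- s)) \<longlongrightarrow> 0) at_top"
proof -
  have "((\<lambda>s. \<Sum>i\<le>degree p. coeff p i * (s ^ i / exp s)) \<longlongrightarrow> (\<Sum>i\<le>degree p. coeff p i * 0)) at_top"
    by (intro tendsto_intros tendsto_power_div_exp_0)
  then show ?thesis
    by (simp add: poly_altdef exp_minus field_simps sum_distrib_right sum_distrib_left sum_divide_distrib)
qed

lemma flat_tendsto_0: "(flat p \<longlongrightarrow> 0) (at 0)"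
proof (rule filterlim_split_at)
  show "(flat p \<longlongrightarrow> 0) (at_left 0)"
    by (rule tendsto_eventually) (auto simp: flat_def eventually_at_filter)
  have "((\<lambda>x. poly p (inverse x) * exp (- inverse x)) \<longlongrightarrow> 0) (at_right 0)"
    using filterlim_compose[OF poly_mult_exp_neg_tendsto_0 filterlim_inverse_at_top_right] .
  then show "(flat p \<longlongrightarrow> 0) (at_right 0)"
    by (rule Lim_transform_eventually) (auto simp: flat_def eventually_at_filter inverse_eq_divide)
qed

text \<open>
  At \<open>0\<close> the difference quotient of \<open>flat p\<close> is again a flat function, namely \<open>flat (pCons 0 p)\<close>,
  because division by \<open>x\<close> multiplies \<open>p\<close> by its variable \<open>1/x\<close>.
\<close>
lemma flat_has_derivative:
  "(flat p has_real_derivative flat ([:0, 0, 1:] * (p - pderiv p)) x) (at x)"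
proof (cases x "0::real" rule: linorder_cases)
  case less
  have "((\<lambda>x. 0) has_real_derivative 0) (at x)" by simp
  then have "(flat p has_real_derivative 0) (at x)"
    by (rule has_field_derivative_transform_within_open[where S = "{..<0}"]) (use less in \<open>auto simp: flat_def\<close>)
  then show ?thesis using less by (simp add: flat_def)
next
  case equal
  have "((\<lambda>y. (flat p y - flat p 0) / (y - 0)) \<longlongrightarrow> 0) (at 0)"
    by (rule Lim_transform_eventually[OF flat_tendsto_0[of "pCons 0 p"]])
      (auto simp: flat_def eventually_at_filter)
  then show ?thesis using equal by (simp add: has_field_derivative_iff flat_def)
next
  case greater
  have "((\<lambda>x. poly p (1 / x) * exp (- (1 / x))) has_real_derivative
      flat ([:0, 0, 1:] * (p - pderiv p)) x) (at x)"
    using greater by (auto intro!: derivative_eq_intros simp: flat_def field_simps power2_eq_square)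
  then show ?thesis
    by (rule has_field_derivative_transform_within_open[where S = "{0<..}"]) (use greater in \<open>auto simp: flat_def\<close>)
qed

lemma Ck_on_flat: "Ck_on k UNIV (flat p)"
proof (induction k arbitrary: p)
  case 0
  then show ?case
    using flat_has_derivative by (auto intro!: DERIV_continuous_on simp: has_field_derivative_at_within)
next
  case (Suc k)
  show ?case
    by (rule Ck_on_Suc_I[OF open_UNIV flat_has_derivative[unfolded has_field_derivative_def]])
      (intro Ck_on_bounded_bilinear[OF bounded_bilinear_mult] Suc Ck_on_const open_UNIV)
qed

text \<open>
  The inner function \<open>flat 1 (1 - t)\<close> vanishes for \<open>t \<ge> 1\<close> and is at least \<open>flat 1 1\<close> for \<open>t \<le> 0\<close>,
  where the outer function therefore sees a nonpositive argument. The denominator is a constant,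
  so smoothness follows from the composition rule alone.
\<close>
definition smooth_step :: "real \<Rightarrow> real" where
  "smooth_step t = flat 1 (flat 1 1 - flat 1 (1 - t)) / flat 1 (flat 1 1)"

lemma flat_1_mono: "x \<le> y \<Longrightarrow> flat 1 x \<le> flat 1 y"
  by (auto simp: flat_def frac_le)

lemma smooth_step:
  shows smooth_step_eq_0: "t \<le> 0 \<Longrightarrow> smooth_step t = 0"
    and smooth_step_eq_1: "1 \<le> t \<Longrightarrow> smooth_step t = 1"
    and smooth_step_nonneg: "0 \<le> smooth_step t"
    and smooth_step_le_1: "smooth_step t \<le> 1"
proof -
  have pos: "flat 1 1 > 0" "flat 1 (flat 1 1) > 0"
    by (auto simp: flat_def)
  have nonneg: "flat 1 x \<ge> 0" for x
    by (auto simp: flat_def)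
  have nonpos: "flat 1 x = 0" if "x \<le> 0" for x
    using that by (auto simp: flat_def)
  show "smooth_step t = 0" if "t \<le> 0"
    using nonpos[of "flat 1 1 - flat 1 (1 - t)"] flat_1_mono[of 1 "1 - t"] that
    by (simp add: smooth_step_def)
  show "smooth_step t = 1" if "1 \<le> t"
    using nonpos[of "1 - t"] pos that by (simp add: smooth_step_def)
  show "0 \<le> smooth_step t"
    using nonneg by (simp add: smooth_step_def)
  show "smooth_step t \<le> 1"
    using flat_1_mono[of "flat 1 1 - flat 1 (1 - t)" "flat 1 1"] nonneg[of "1 - t"] pos
    by (simp add: smooth_step_def)
qed

lemma Ck_on_smooth_step: "Ck_on k UNIV smooth_step"
proof -
  have "Ck_on k UNIV (\<lambda>t. inverse (flat 1 (flat 1 1)) * flat 1 (flat 1 1 - flat 1 (1 - t)))"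
    by (intro Ck_on_bounded_bilinear[OF bounded_bilinear_mult] Ck_on_compose_real[OF _ Ck_on_flat]
        Ck_on_diff Ck_on_const Ck_on_bounded_linear[OF bounded_linear_ident] open_UNIV)
  then show ?thesis
    by (simp add: smooth_step_def[abs_def] divide_inverse mult.commute)
qed

lemma smooth_bump_exists:
  fixes c :: "'a::euclidean_space"
  assumes "r > 0"
  obtains \<eta> :: "'a \<Rightarrow> real" where "\<And>k U. open U \<Longrightarrow> Ck_on k U \<eta>" "\<And>x. 0 \<le> \<eta> x" "\<And>x. \<eta> x \<le> 1"
    "\<And>x. dist c x \<le> r / 2 \<Longrightarrow> \<eta> x = 1" "\<And>x. r \<le> dist c x \<Longrightarrow> \<eta> x = 0"
proof -
  \<comment> \<open>The factor makes \<open>u\<close> equal to \<open>1\<close> at distance \<open>r / 2\<close> and \<open>0\<close> at distance \<open>r\<close>.\<close>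
  define u where "u x = 4 / (3 * r\<^sup>2) * (r\<^sup>2 - (x - c) \<bullet> (x - c))" for x
  have u: "u x = 4 / (3 * r\<^sup>2) * (r\<^sup>2 - (dist c x)\<^sup>2)" for x
    using power2_norm_eq_inner[of "x - c"] by (simp add: u_def dist_norm norm_minus_commute[of c x])
  have "Ck_on k U u" if "open U" for k U
    unfolding u_def[abs_def]
    by (intro Ck_on_bounded_bilinear[OF bounded_bilinear_mult] Ck_on_bounded_bilinear[OF bounded_bilinear_inner]
        Ck_on_diff Ck_on_const Ck_on_bounded_linear[OF bounded_linear_ident] that)
  then have 1: "Ck_on k U (\<lambda>x. smooth_step (u x))" if "open U" for k U
    by (rule Ck_on_compose_real[OF that Ck_on_smooth_step]) (rule that)
  have 2: "u x \<ge> 1" if "dist c x \<le> r / 2" for x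
  proof -
    have "(dist c x)\<^sup>2 \<le> (r / 2)\<^sup>2"
      using that by (intro power_mono) auto
    then show ?thesis using assms by (simp add: u field_simps power2_eq_square)
  qed
  have 3: "u x \<le> 0" if "r \<le> dist c x" for x
  proof -
    have "r\<^sup>2 \<le> (dist c x)\<^sup>2"
      using that assms by (intro power_mono) auto
    then show ?thesis unfolding u by (intro mult_nonneg_nonpos) auto
  qed
  show ?thesis
    by (rule that[of "\<lambda>x. smooth_step (u x)"])
      (use 1 2 3 in \<open>auto simp: smooth_step\<close>)
qed

section \<open>Smooth averaging\<close>

text \<open>
  The weights \<open>\<eta> j * (\<Prod>i<j. 1 - \<eta> i)\<close> give a partition of unity without any division: as soon as one
  \<open>\<eta> i\<close> equals \<open>1\<close>, they add up to \<open>1\<close> and all later weights vanish.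
\<close>
lemma sum_telescoping_weights:
  fixes \<eta> :: "nat \<Rightarrow> 'a::comm_ring_1"
  shows "(\<Sum>j<n. \<eta> j * (\<Prod>i<j. 1 - \<eta> i)) = 1 - (\<Prod>i<n. 1 - \<eta> i)"
  by (induction n) (simp_all add: algebra_simps)

text \<open>
  Countably many of the half-size balls \<open>ball c (r c / 2)\<close> have the same union \<open>U\<close> as all of them. With
  bump functions that equal \<open>1\<close> on the chosen half-size balls and vanish outside the full-size ones,
  the telescoping weights are locally finite on \<open>U\<close>: on the half-size ball \<open>H n\<close> only the weights
  with index at most \<open>n\<close> survive. Averaging the values \<open>p (c j)\<close> with these weights is therefore
  smooth, and a point \<open>x\<close> only receives contributions from centers \<open>c j\<close> whose full-size ball
  contains it.
\<close>
lemma smooth_averaging: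
  fixes X :: "'a::euclidean_space set" and p :: "'a \<Rightarrow> 'b::euclidean_space"
  assumes r: "\<And>c. c \<in> X \<Longrightarrow> 0 < r c"
  obtains U G where "open U" "X \<subseteq> U" "smooth_on U G"
    "\<And>x. x \<in> U \<Longrightarrow> G x \<in> convex hull {p c |c. c \<in> X \<and> dist c x < r c}"
proof (cases "X = {}")
  case True
  then show ?thesis
    using that[of "{}" "\<lambda>_. 0"] by (simp add: smooth_on_def Ck_on_const)
next
  case False
  obtain D where D: "D \<subseteq> X" "countable D" "(\<Union>c\<in>D. ball c (r c / 2)) = (\<Union>c\<in>X. ball c (r c / 2))"
  proof -
    obtain \<F> where \<F>: "\<F> \<subseteq> (\<lambda>c. ball c (r c / 2)) ` X" "countable \<F>"
        "\<Union>\<F> = (\<Union>c\<in>X. ball c (r c / 2))"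
      using Lindelof[of "(\<lambda>c. ball c (r c / 2)) ` X"] by auto
    then obtain D where "countable D" "D \<subseteq> X" "\<F> = (\<lambda>c. ball c (r c / 2)) ` D"
      using countable_subset_image[of \<F> "\<lambda>c. ball c (r c / 2)" X] by blast
    with \<F>(3) show ?thesis using that by blast
  qed
  define U where "U = (\<Union>c\<in>X. ball c (r c / 2))"
  have "open U" by (auto simp: U_def)
  have "X \<subseteq> U" using r by (force simp: U_def)
  with False have "U \<noteq> {}" by blast
  then have "D \<noteq> {}" unfolding U_def D(3)[symmetric] by blast
  define c where "c = from_nat_into D"
  have c: "c n \<in> X" for n
    using from_nat_into[OF \<open>D \<noteq> {}\<close>] D(1) by (auto simp: c_def)
  define H where "H n = ball (c n) (r (c n) / 2)" for n
  have U_eq: "U = (\<Union>n. H n)"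
  proof -
    have "D = range c"
      using range_from_nat_into[OF \<open>D \<noteq> {}\<close> D(2)] by (simp add: c_def)
    then show ?thesis
      unfolding U_def H_def D(3)[symmetric] by simp
  qed
  have "\<exists>\<eta> :: 'a \<Rightarrow> real. (\<forall>k U. open U \<longrightarrow> Ck_on k U \<eta>) \<and> (\<forall>x. 0 \<le> \<eta> x \<and> \<eta> x \<le> 1) \<and>
    (\<forall>x\<in>H n. \<eta> x = 1) \<and> (\<forall>x. r (c n) \<le> dist (c n) x \<longrightarrow> \<eta> x = 0)" for n
  proof -
    obtain \<eta> :: "'a \<Rightarrow> real" where "\<And>k U. open U \<Longrightarrow> Ck_on k U \<eta>" "\<And>x. 0 \<le> \<eta> x" "\<And>x. \<eta> x \<le> 1"
      "\<And>x. dist (c n) x \<le> r (c n) / 2 \<Longrightarrow> \<eta> x = 1" "\<And>x. r (c n) \<le> dist (c n) x \<Longrightarrow> \<eta> x = 0"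
      by (rule smooth_bump_exists[where c = "c n", OF r[OF c[of n]]]) blast
    then show ?thesis
      by (intro exI[of _ \<eta>]) (simp add: H_def)
  qed
  then obtain \<eta> :: "nat \<Rightarrow> 'a \<Rightarrow> real" where
    \<eta>_Ck: "\<And>n k U. open U \<Longrightarrow> Ck_on k U (\<eta> n)" and
    \<eta>_range: "\<And>n x. 0 \<le> \<eta> n x" "\<And>n x. \<eta> n x \<le> 1" and
    \<eta>_1: "\<And>n x. x \<in> H n \<Longrightarrow> \<eta> n x = 1" and
    \<eta>_0: "\<And>n x. r (c n) \<le> dist (c n) x \<Longrightarrow> \<eta> n x = 0"
    by metis
  define \<phi> where "\<phi> j x = \<eta> j x * (\<Prod>i<j. 1 - \<eta> i x)" for j x
  define S where "S n x = (\<Sum>j\<le>n. \<phi> j x *\<^sub>R p (c j))" for n x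
  have S_Ck: "Ck_on k V (S n)" if "open V" for k n V
    unfolding S_def[abs_def] \<phi>_def
    by (intro Ck_on_sum Ck_on_bounded_bilinear[OF bounded_bilinear_scaleR]
        Ck_on_bounded_bilinear[OF bounded_bilinear_mult] Ck_on_prod Ck_on_diff Ck_on_const \<eta>_Ck that)
  have \<phi>_0: "\<phi> j x = 0" if "x \<in> H n" "n < j" for x n j
    unfolding \<phi>_def using \<eta>_1[OF that(1)] that(2) by auto
  have S_stable: "S m x = S n x" if "x \<in> H n" "n \<le> m" for x m n
    unfolding S_def using \<phi>_0[OF that(1)] that(2)
    by (intro sum.mono_neutral_right) auto
  have S_hull: "S n x \<in> convex hull {p c |c. c \<in> X \<and> dist c x < r c}" if "x \<in> H n" for x n
  proof -
    let ?J = "{j. j \<le> n \<and> \<phi> j x \<noteq> 0}"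
    have "(\<Prod>i\<le>n. 1 - \<eta> i x) = 0"
      using \<eta>_1[OF that] by auto
    then have "(\<Sum>j\<le>n. \<phi> j x) = 1"
      using sum_telescoping_weights[of "\<lambda>i. \<eta> i x" "Suc n"]
      by (simp only: lessThan_Suc_atMost \<phi>_def)
    moreover have "(\<Sum>j\<in>?J. \<phi> j x) = (\<Sum>j\<le>n. \<phi> j x)"
      by (intro sum.mono_neutral_left) auto
    moreover have "S n x = (\<Sum>j\<in>?J. \<phi> j x *\<^sub>R p (c j))"
      unfolding S_def by (intro sum.mono_neutral_right) auto
    moreover have "0 \<le> \<phi> j x" for j
      unfolding \<phi>_def using \<eta>_range by (intro mult_nonneg_nonneg prod_nonneg) auto
    moreover have "p (c j) \<in> convex hull {p c |c. c \<in> X \<and> dist c x < r c}" if "\<phi> j x \<noteq> 0" for j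
    proof (rule hull_inc)
      have "\<eta> j x \<noteq> 0"
        using that by (auto simp: \<phi>_def)
      then show "p (c j) \<in> {p c |c. c \<in> X \<and> dist c x < r c}"
        using c \<eta>_0[of j x] by force
    qed
    ultimately show ?thesis
      by (auto intro!: convex_sum)
  qed
  \<comment> \<open>The value of the infinite sum: the partial sums are constant from any \<open>n\<close> with \<open>x \<in> H n\<close> on.\<close>
  define N where "N x = (LEAST n. x \<in> H n)" for x
  define G where "G x = S (N x) x" for x
  have N: "x \<in> H (N x)" if "x \<in> H n" for x n
    unfolding N_def using that by (rule LeastI)
  have G_eq: "G x = S n x" if "x \<in> H n" for x n
    unfolding G_def using S_stable[OF N[OF that], of n] Least_le[of "\<lambda>n. x \<in> H n", OF that]
    by (simp add: N_def)
  have "Ck_on k U G" for k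
  proof (rule Ck_on_locally)
    fix x assume "x \<in> U"
    then obtain n where n: "x \<in> H n" by (auto simp: U_eq)
    have "open (H n)" by (simp add: H_def)
    then have "Ck_on k (H n) G"
      using S_Ck G_eq by (intro Ck_on_cong[of "H n" k "S n" G]) auto
    with n \<open>open (H n)\<close> show "\<exists>V. open V \<and> x \<in> V \<and> Ck_on k V G" by blast
  qed
  then have "smooth_on U G" by (simp add: smooth_on_def)
  moreover have "G x \<in> convex hull {p c |c. c \<in> X \<and> dist c x < r c}" if "x \<in> U" for x
    using that G_eq S_hull by (auto simp: U_eq)
  ultimately show ?thesis
    using that \<open>open U\<close> \<open>X \<subseteq> U\<close> by blast
qed

section \<open>Density of the smooth maps\<close>

lemma simplex_closed_convex:
  fixes S :: "'a::euclidean_space set"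
  assumes "locally_finite_simplicial_complex L" "S \<in> L"
  shows "closed S" "convex S"
proof -
  have "is_simplex S"
    using assms by (simp add: locally_finite_simplicial_complex_def)
  then obtain A where "finite A" "S = convex hull A"
    unfolding is_simplex_def by blast
  then show "closed S" "convex S"
    by (simp_all add: finite_imp_compact_convex_hull compact_imp_closed)
qed

text \<open>
  Of the finitely many simplices that meet some neighborhood of \<open>y\<close>, those that miss \<open>y\<close> form a
  closed set, and removing it leaves a smaller neighborhood.
\<close>
lemma locally_finite_complex_nbhd:
  fixes L :: "'a::euclidean_space set set"
  assumes L: "locally_finite_simplicial_complex L" and "y \<in> \<Union>L"
  obtains N where "openin (top_of_set (\<Union>L)) N" "y \<in> N"
    "\<And>S z. S \<in> L \<Longrightarrow> z \<in> S \<Longrightarrow> z \<in> N \<Longrightarrow> y \<in> S"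
proof -
  obtain V where V: "openin (top_of_set (\<Union>L)) V" "y \<in> V" "finite {S\<in>L. S \<inter> V \<noteq> {}}"
    using assms unfolding locally_finite_simplicial_complex_def by blast
  define C where "C = \<Union>{S\<in>L. S \<inter> V \<noteq> {} \<and> y \<notin> S}"
  have "closed S" if "S \<in> L" for S
    using simplex_closed_convex[OF L that] by blast
  moreover have "finite {S\<in>L. S \<inter> V \<noteq> {} \<and> y \<notin> S}"
    by (rule finite_subset[OF _ V(3)]) auto
  ultimately have "closed C"
    unfolding C_def by (intro closed_Union) auto
  then have "openin (top_of_set (\<Union>L)) (V - C)"
    using V(1) by (metis Diff_eq inf.commute open_Compl openin_Int_open)
  then show ?thesis
    by (rule that) (use V in \<open>auto simp: C_def\<close>)
qed

text \<open>
  The radii \<open>r c\<close> are chosen so that \<open>dist c x < r c\<close> puts \<open>f c\<close> both into the ball of radius \<open>\<epsilon> x\<close>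
  around \<open>f x\<close> and into every simplex that contains \<open>f x\<close>. Both sets are convex, so they contain
  the averages of such values.
\<close>
lemma smooth_approximation_into_polyhedron:
  fixes X :: "'m::euclidean_space set" and L :: "'n::euclidean_space set set"
  assumes X: "locally compact X" and L: "locally_finite_simplicial_complex L"
    and f: "f \<in> C0_maps X (\<Union>L)"
    and \<epsilon>: "continuous_on X \<epsilon>" "\<And>x. x \<in> X \<Longrightarrow> 0 < \<epsilon> x"
  obtains g where "g \<in> Cinf_maps X (\<Union>L)" "\<And>x. x \<in> X \<Longrightarrow> norm (g x - f x) < \<epsilon> x"
proof -
  have cf: "continuous_on X f" and fP: "\<And>x. x \<in> X \<Longrightarrow> f x \<in> \<Union>L"
    using f by (auto simp: C0_maps_def)
  have "\<exists>\<rho>>0. \<forall>x\<in>X. dist c x < \<rho> \<longrightarrow>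
      dist (f c) (f x) < \<epsilon> x \<and> (\<forall>S\<in>L. f x \<in> S \<longrightarrow> f c \<in> S)" if c: "c \<in> X" for c
  proof -
    obtain N where N: "openin (top_of_set (\<Union>L)) N" "f c \<in> N"
      "\<And>S z. S \<in> L \<Longrightarrow> z \<in> S \<Longrightarrow> z \<in> N \<Longrightarrow> f c \<in> S"
      using locally_finite_complex_nbhd[OF L fP[OF c]] by metis
    have "openin (top_of_set X) (X \<inter> f -` N)"
      using fP by (intro continuous_openin_preimage[OF cf _ N(1)]) auto
    \<comment> \<open>The bound is \<open>\<epsilon> x\<close> and not \<open>\<epsilon> c\<close>, so the condition on \<open>x\<close> is an open one by continuity of both \<open>f\<close> and \<open>\<epsilon>\<close>.\<close>
    moreover have "openin (top_of_set X) (X \<inter> (\<lambda>x. \<epsilon> x - dist (f c) (f x)) -` {0<..})"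
      by (intro continuous_openin_preimage_gen continuous_intros cf \<epsilon>)
    ultimately have "openin (top_of_set X) (X \<inter> f -` N \<inter> (X \<inter> (\<lambda>x. \<epsilon> x - dist (f c) (f x)) -` {0<..}))"
      by (rule openin_Int)
    moreover have "c \<in> X \<inter> f -` N \<inter> (X \<inter> (\<lambda>x. \<epsilon> x - dist (f c) (f x)) -` {0<..})"
      using c N(2) \<epsilon>(2) by auto
    ultimately obtain \<rho> where \<rho>: "\<rho> > 0"
        "ball c \<rho> \<inter> X \<subseteq> X \<inter> f -` N \<inter> (X \<inter> (\<lambda>x. \<epsilon> x - dist (f c) (f x)) -` {0<..})"
      unfolding openin_contains_ball by blast
    have "dist (f c) (f x) < \<epsilon> x \<and> (\<forall>S\<in>L. f x \<in> S \<longrightarrow> f c \<in> S)" if "x \<in> X" "dist c x < \<rho>" for x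
    proof -
      have "f x \<in> N" "dist (f c) (f x) < \<epsilon> x"
        using \<rho>(2) that by (auto dest!: subsetD[where c = x])
      then show ?thesis using N(3) by blast
    qed
    with \<rho>(1) show ?thesis by blast
  qed
  then have "\<forall>c\<in>X. \<exists>\<rho>. \<rho> > 0 \<and> (\<forall>x\<in>X. dist c x < \<rho> \<longrightarrow>
      dist (f c) (f x) < \<epsilon> x \<and> (\<forall>S\<in>L. f x \<in> S \<longrightarrow> f c \<in> S))"
    by blast
  from bchoice[OF this] obtain r where R: "\<forall>c\<in>X. r c > 0 \<and> (\<forall>x\<in>X. dist c x < r c \<longrightarrow>
      dist (f c) (f x) < \<epsilon> x \<and> (\<forall>S\<in>L. f x \<in> S \<longrightarrow> f c \<in> S))"
    by blast
  then have r: "\<And>c. c \<in> X \<Longrightarrow> 0 < r c"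
    and near: "\<And>c x. c \<in> X \<Longrightarrow> x \<in> X \<Longrightarrow> dist c x < r c \<Longrightarrow> dist (f c) (f x) < \<epsilon> x"
    and simplex: "\<And>c x S. c \<in> X \<Longrightarrow> x \<in> X \<Longrightarrow> dist c x < r c \<Longrightarrow> S \<in> L \<Longrightarrow> f x \<in> S \<Longrightarrow> f c \<in> S"
    by auto
  obtain U G where U: "open U" "X \<subseteq> U" and G: "smooth_on U G"
    and hull: "\<And>x. x \<in> U \<Longrightarrow> G x \<in> convex hull {f c |c. c \<in> X \<and> dist c x < r c}"
    by (rule smooth_averaging[where r = r and p = f, OF r]) blast+
  obtain T where T: "open T" "closedin (top_of_set T) X"
    using locally_compact_closedin_open[OF X] .
  have "X \<subseteq> T"
    using closedin_imp_subset[OF T(2)] .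
  have GP: "G x \<in> \<Union>L" if x: "x \<in> X" for x
  proof -
    obtain S where S: "S \<in> L" "f x \<in> S" using fP[OF x] by blast
    have "convex S"
      using simplex_closed_convex[OF L S(1)] by blast
    moreover have "{f c |c. c \<in> X \<and> dist c x < r c} \<subseteq> S"
      using simplex x S by blast
    ultimately show ?thesis
      using hull[of x] x U(2) S(1) hull_minimal[of _ S convex] by blast
  qed
  have G_near: "norm (G x - f x) < \<epsilon> x" if x: "x \<in> X" for x
  proof -
    have "{f c |c. c \<in> X \<and> dist c x < r c} \<subseteq> ball (f x) (\<epsilon> x)"
      using near x by (auto simp: dist_commute)
    then have "G x \<in> ball (f x) (\<epsilon> x)"
      using hull[of x] x U(2) hull_minimal[of _ "ball (f x) (\<epsilon> x)" convex] by blast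
    then show ?thesis
      by (simp add: dist_norm norm_minus_commute)
  qed
  \<comment> \<open>\<open>X\<close> may fail to be closed in \<open>U\<close>, but it is closed in \<open>T\<close>.\<close>
  have "smooth_on (U \<inter> T) G"
    using G Ck_on_subset[of _ U G "U \<inter> T"] by (auto simp: smooth_on_def)
  moreover have "closedin (top_of_set (U \<inter> T)) X"
    using T(2) U(2) \<open>X \<subseteq> T\<close> by (meson Int_greatest closedin_subset_trans inf_le2)
  ultimately have "restrict G X \<in> Cinf_maps X (\<Union>L)"
    using GP U T(1) \<open>X \<subseteq> T\<close> unfolding Cinf_maps_def
    by (auto intro!: exI[of _ "U \<inter> T"] exI[of _ G])
  then show ?thesis
    using that G_near by (metis restrict_apply')
qed

lemma Cinf_maps_dense:
  fixes X :: "'m::euclidean_space set" and P :: "'n::euclidean_space set"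
  assumes "locally compact X" "locally_compact_polyhedron P"
  shows "strong_C0_topology X P closure_of Cinf_maps X P = C0_maps X P"
proof
  show "strong_C0_topology X P closure_of Cinf_maps X P \<subseteq> C0_maps X P"
    using closure_of_subset_topspace topspace_strong_C0_topology by metis
  obtain L where L: "locally_finite_simplicial_complex L" "P = \<Union>L"
    using assms(2) unfolding locally_compact_polyhedron_def by blast
  show "C0_maps X P \<subseteq> strong_C0_topology X P closure_of Cinf_maps X P"
  proof
    fix f assume f: "f \<in> C0_maps X P"
    have "\<exists>g \<in> Cinf_maps X P. g \<in> W" if W: "strong_C0_open X P W" "f \<in> W" for W
    proof -
      obtain \<epsilon> where \<epsilon>: "continuous_on X \<epsilon>" "\<And>x. x \<in> X \<Longrightarrow> 0 < \<epsilon> x" "strong_nbhd X P f \<epsilon> \<subseteq> W"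
        using W unfolding strong_C0_open_def by blast
      obtain g where "g \<in> Cinf_maps X P" "\<And>x. x \<in> X \<Longrightarrow> norm (g x - f x) < \<epsilon> x"
        using smooth_approximation_into_polyhedron[OF assms(1) L(1) f[unfolded L(2)] \<epsilon>(1,2)] L(2)
        by metis
      with \<epsilon>(3) show ?thesis
        using Cinf_maps_subset_C0_maps unfolding strong_nbhd_def by blast
    qed
    with f show "f \<in> strong_C0_topology X P closure_of Cinf_maps X P"
      by (auto simp: in_closure_of topspace_strong_C0_topology openin_strong_C0_topology)
  qed
qed

section \<open>Polyhedra under linear embeddings\<close>

lemma is_simplex_injective_linear_image:
  fixes \<phi> :: "'a::real_normed_vector \<Rightarrow> 'b::real_normed_vector"
  assumes \<phi>: "bounded_linear \<phi>" "inj \<phi>" and S: "is_simplex S"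
  shows "is_simplex (\<phi> ` S)"
proof -
  interpret bounded_linear \<phi> by fact
  obtain C where C: "finite C" "\<not> affine_dependent C" "S = convex hull C"
    using S unfolding is_simplex_def by blast
  have "\<not> affine_dependent (\<phi> ` C)"
  proof
    assume "affine_dependent (\<phi> ` C)"
    then obtain x where x: "x \<in> C" "\<phi> x \<in> affine hull (\<phi> ` C - {\<phi> x})"
      unfolding affine_dependent_def by blast
    have "\<phi> ` C - {\<phi> x} = \<phi> ` (C - {x})"
      using image_set_diff[OF \<phi>(2)] by force
    then have "\<phi> x \<in> \<phi> ` (affine hull (C - {x}))"
      using x(2) affine_hull_linear_image[OF \<phi>(1)] by metis
    then have "x \<in> affine hull (C - {x})"
      using \<phi>(2) by (auto dest: injD)
    with x(1) C(2) show False
      unfolding affine_dependent_def by blast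
  qed
  moreover have "\<phi> ` S = convex hull (\<phi> ` C)"
    using C(3) convex_hull_linear_image[OF linear] by metis
  ultimately show ?thesis
    unfolding is_simplex_def using C(1) by blast
qed

lemma locally_finite_simplicial_complex_linear_image:
  fixes \<phi> :: "'a::real_normed_vector \<Rightarrow> 'b::real_normed_vector"
  assumes \<phi>: "bounded_linear \<phi>" "inj \<phi>"
    and hom: "homeomorphism (\<Union>L) (\<phi> ` \<Union>L) \<phi> \<psi>"
    and L: "locally_finite_simplicial_complex L"
  shows "locally_finite_simplicial_complex ((`) \<phi> ` L)"
proof -
  interpret bounded_linear \<phi> by fact
  note face = face_of_linear_image[OF linear \<phi>(2)]
  show ?thesis
    unfolding locally_finite_simplicial_complex_def
  proof (intro conjI ballI allI impI; (elim conjE)?)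
    fix S assume "S \<in> (`) \<phi> ` L"
    then show "is_simplex S"
      using L is_simplex_injective_linear_image[OF \<phi>]
      unfolding locally_finite_simplicial_complex_def by blast
  next
    fix F S assume S: "S \<in> (`) \<phi> ` L" and F: "F face_of S"
    obtain S0 where S0: "S0 \<in> L" "S = \<phi> ` S0" using S by blast
    \<comment> \<open>A face of an image is itself an image, since it is a subset.\<close>
    obtain F0 where F0: "F = \<phi> ` F0"
      using face_of_imp_subset[OF F] S0(2) by (metis subset_imageE)
    have "F0 face_of S0"
      using F face unfolding S0(2) F0 by blast
    then show "F \<in> (`) \<phi> ` L"
      using L S0(1) F0 unfolding locally_finite_simplicial_complex_def by blast
  next
    fix S S' assume "S \<in> (`) \<phi> ` L" "S' \<in> (`) \<phi> ` L"
    then obtain S0 S0' where S: "S0 \<in> L" "S = \<phi> ` S0" "S0' \<in> L" "S' = \<phi> ` S0'" by blast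
    have "(S0 \<inter> S0') face_of S0"
      using L S(1,3) unfolding locally_finite_simplicial_complex_def by blast
    then show "(S \<inter> S') face_of S"
      using face unfolding S(2,4) image_Int[OF \<phi>(2), symmetric] by blast
  next
    fix y assume "y \<in> \<Union>((`) \<phi> ` L)"
    then obtain x where x: "x \<in> \<Union>L" "y = \<phi> x" by blast
    then obtain V where V: "openin (top_of_set (\<Union>L)) V" "x \<in> V" "finite {S\<in>L. S \<inter> V \<noteq> {}}"
      using L unfolding locally_finite_simplicial_complex_def by blast
    have "openin (top_of_set (\<Union>((`) \<phi> ` L))) (\<phi> ` V)"
      using homeomorphism_imp_open_map[OF hom V(1)] by (simp add: image_Union)
    moreover have "y \<in> \<phi> ` V"
      using V(2) x(2) by blast
    moreover have "{S \<in> (`) \<phi> ` L. S \<inter> \<phi> ` V \<noteq> {}} \<subseteq> (`) \<phi> ` {S\<in>L. S \<inter> V \<noteq> {}}"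
      using \<phi>(2) by (auto dest: injD)
    then have "finite {S \<in> (`) \<phi> ` L. S \<inter> \<phi> ` V \<noteq> {}}"
      by (rule finite_surj[OF V(3)])
    ultimately show "\<exists>V. openin (top_of_set (\<Union>((`) \<phi> ` L))) V \<and> y \<in> V \<and>
        finite {S \<in> (`) \<phi> ` L. S \<inter> V \<noteq> {}}"
      by blast
  qed
qed

text \<open>
  The left inverse \<open>\<psi>\<close> is continuous on the whole sequence space, because it depends on finitely many
  coordinates. So \<open>\<phi>\<close> is a homeomorphism onto its image.
\<close>
lemma coord_space_embedding:
  obtains \<phi> :: "'n::euclidean_space \<Rightarrow> (nat \<Rightarrow>\<^sub>C real)" and \<psi>
  where "bounded_linear \<phi>" "range \<phi> \<subseteq> coord_space DIM('n)" "continuous_on UNIV \<psi>" "\<And>x. \<psi> (\<phi> x) = x"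
proof -
  obtain b where b: "bij_betw b {..<DIM('n)} (Basis :: 'n set)"
    by (metis ex_bij_betw_nat_finite finite_Basis lessThan_atLeast0)
  define \<phi> :: "'n \<Rightarrow> (nat \<Rightarrow>\<^sub>C real)" where
    "\<phi> x = Bcontfun (\<lambda>i. if i < DIM('n) then x \<bullet> b i else 0)" for x
  have \<phi>: "apply_bcontfun (\<phi> x) i = (if i < DIM('n) then x \<bullet> b i else 0)" for x i
  proof -
    have "(\<lambda>i. if i < DIM('n) then x \<bullet> b i else 0) \<in> bcontfun"
    proof (rule bcontfun_normI)
      fix i
      show "norm (if i < DIM('n) then x \<bullet> b i else 0) \<le> norm x"
        using Basis_le_norm[of "b i" x] b by (auto simp: bij_betw_def)
    qed (simp add: continuous_on_discrete)
    then show ?thesis by (simp add: \<phi>_def Bcontfun_inverse)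
  qed
  define \<psi> :: "(nat \<Rightarrow>\<^sub>C real) \<Rightarrow> 'n" where
    "\<psi> y = (\<Sum>i<DIM('n). apply_bcontfun y i *\<^sub>R b i)" for y
  have "linear \<phi>"
    by (intro linearI bcontfun_eqI) (simp_all add: \<phi> inner_add_left)
  then have "bounded_linear \<phi>"
    by (simp add: linear_conv_bounded_linear)
  moreover have "range \<phi> \<subseteq> coord_space DIM('n)"
    by (auto simp: coord_space_def \<phi>)
  moreover have "continuous_on UNIV (\<lambda>y :: nat \<Rightarrow>\<^sub>C real. apply_bcontfun y i)" for i
    unfolding continuous_on_iff using dist_fun_lt_imp_dist_val_lt by blast
  then have "continuous_on UNIV \<psi>"
    unfolding \<psi>_def by (intro continuous_intros)
  moreover have "\<psi> (\<phi> x) = x" for x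
  proof -
    have "\<psi> (\<phi> x) = (\<Sum>i<DIM('n). (x \<bullet> b i) *\<^sub>R b i)"
      by (simp add: \<psi>_def \<phi>)
    also have "\<dots> = (\<Sum>u\<in>Basis. (x \<bullet> u) *\<^sub>R u)"
      using sum.reindex_bij_betw[OF b, of "\<lambda>u. (x \<bullet> u) *\<^sub>R u"] .
    finally show ?thesis by (simp add: euclidean_representation)
  qed
  ultimately show ?thesis using that by blast
qed

lemma triangulable_polyhedron:
  fixes P :: "'n::euclidean_space set"
  assumes "locally_compact_polyhedron P" "P \<noteq> {}"
  shows "triangulable P"
proof -
  obtain L where L: "locally_finite_simplicial_complex L" "P = \<Union>L"
    using assms(1) unfolding locally_compact_polyhedron_def by blast
  obtain \<phi> :: "'n \<Rightarrow> (nat \<Rightarrow>\<^sub>C real)" and \<psi> where \<phi>: "bounded_linear \<phi>"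
    "range \<phi> \<subseteq> coord_space DIM('n)" "continuous_on UNIV \<psi>" "\<And>x. \<psi> (\<phi> x) = x"
    using coord_space_embedding by blast
  have "inj \<phi>" using \<phi>(4) by (metis injI)
  have hom: "homeomorphism P (\<phi> ` P) \<phi> \<psi>"
    using \<phi>(3,4) linear_continuous_on[OF \<phi>(1)]
    by (auto simp: homeomorphism_def image_image intro: continuous_on_subset)
  then have "locally_finite_simplicial_complex ((`) \<phi> ` L)"
    using locally_finite_simplicial_complex_linear_image[OF \<phi>(1) \<open>inj \<phi>\<close> _ L(1)] L(2) by blast
  then have "locally_compact_polyhedron (\<phi> ` P)"
    unfolding locally_compact_polyhedron_def L(2) by (auto simp: image_Union)
  moreover have "\<phi> ` P \<subseteq> coord_space DIM('n)"
    using \<phi>(2) by blast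
  moreover have "P homeomorphic \<phi> ` P"
    using hom homeomorphic_def by blast
  ultimately show ?thesis
    unfolding triangulable_def using assms(2) by blast
qed

theorem corollary1p8:
  fixes P :: "'n::euclidean_space set"
  assumes "locally_compact_polyhedron P"
    and "P \<noteq> {}"
  shows "Cinf_approximation_target_space TYPE('m::euclidean_space) P"
  unfolding Cinf_approximation_target_space_def
  using triangulable_polyhedron Cinf_maps_dense assms by blast

end
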